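(* Let $G$ be a compact group and $H\le G$ a closed subgroup of finite index. Then: - every free continuous $H$-action on a Tychonoff space is principal if and only if every free continuous $G$-action on a Tychonoff space is principal; - every free continuous $H$-action on a compact Hausdorff space is principal if and only if every free continuous $G$-action on a compact Hausdorff space is principal.
   Context: Compact groups are compact Hausdorff topological groups; Tychonoff spaces are completely regular Hausdorff spaces. A free continuous action of a compact group $K$ on a Tychonoff space $X$ is principal if $X\to X/K$ is a locally trivial principal $K$-bundle, i.e. every point of $X/K$ has an open neighborhood $U$ whose preimage in $X$ is $K$-equivariantly homeomorphic over $U$ to $K\times U$. *)

theory Defs
  imports "HOL-Analysis.Analysis" "HOL-Algebra.Group_Action"
begin

definition topological_group :: "('g, 'b) monoid_scheme \<Rightarrow> 'g topology \<Rightarrow> bool" where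
  "topological_group G T \<longleftrightarrow>
     group G \<and> topspace T = carrier G \<and>
     continuous_map (prod_topology T T) T (\<lambda>(g, h). g \<otimes>\<^bsub>G\<^esub> h) \<and>
     continuous_map T T (\<lambda>g. inv\<^bsub>G\<^esub> g)"

definition compact_group :: "('g, 'b) monoid_scheme \<Rightarrow> 'g topology \<Rightarrow> bool" where
  "compact_group G T \<longleftrightarrow> topological_group G T \<and> compact_space T \<and> Hausdorff_space T"

definition Tychonoff_space :: "'x topology \<Rightarrow> bool" where
  "Tychonoff_space X \<longleftrightarrow> completely_regular_space X \<and> Hausdorff_space X"

text \<open>Actions are left actions. The library's \<^const>\<open>group_action\<close> requires each \<open>\<phi> k\<close> to be
  extensional on the underlying set; this only fixes the irrelevant values outside it.\<close>

definition continuous_action ::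
    "('g, 'b) monoid_scheme \<Rightarrow> 'g topology \<Rightarrow> 'x topology \<Rightarrow> ('g \<Rightarrow> 'x \<Rightarrow> 'x) \<Rightarrow> bool" where
  "continuous_action K T X \<phi> \<longleftrightarrow>
     group_action K (topspace X) \<phi> \<and>
     continuous_map (prod_topology T X) X (\<lambda>(k, x). \<phi> k x)"

definition free_continuous_action ::
    "('g, 'b) monoid_scheme \<Rightarrow> 'g topology \<Rightarrow> 'x topology \<Rightarrow> ('g \<Rightarrow> 'x \<Rightarrow> 'x) \<Rightarrow> bool" where
  "free_continuous_action K T X \<phi> \<longleftrightarrow>
     continuous_action K T X \<phi> \<and>
     (\<forall>x \<in> topspace X. stabilizer K \<phi> x = {\<one>\<^bsub>K\<^esub>})"

definition orbit_space ::
    "('g, 'b) monoid_scheme \<Rightarrow> 'x topology \<Rightarrow> ('g \<Rightarrow> 'x \<Rightarrow> 'x) \<Rightarrow> 'x set topology" where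
  "orbit_space K X \<phi> =
     topology (\<lambda>U. U \<subseteq> orbits K (topspace X) \<phi> \<and>
                    openin X {x \<in> topspace X. orbit K \<phi> x \<in> U})"

lemma openin_orbit_space:
  "openin (orbit_space K X \<phi>) U \<longleftrightarrow>
     U \<subseteq> orbits K (topspace X) \<phi> \<and> openin X {x \<in> topspace X. orbit K \<phi> x \<in> U}"
proof -
  have "istopology (\<lambda>U. U \<subseteq> orbits K (topspace X) \<phi> \<and>
                         openin X {x \<in> topspace X. orbit K \<phi> x \<in> U})"
    unfolding istopology_def
  proof (intro conjI allI impI)
    fix S T
    assume S: "S \<subseteq> orbits K (topspace X) \<phi> \<and> openin X {x \<in> topspace X. orbit K \<phi> x \<in> S}"
      and T: "T \<subseteq> orbits K (topspace X) \<phi> \<and> openin X {x \<in> topspace X. orbit K \<phi> x \<in> T}"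
    show "S \<inter> T \<subseteq> orbits K (topspace X) \<phi>"
      using S by blast
    have "{x \<in> topspace X. orbit K \<phi> x \<in> S \<inter> T} =
          {x \<in> topspace X. orbit K \<phi> x \<in> S} \<inter> {x \<in> topspace X. orbit K \<phi> x \<in> T}"
      by blast
    then show "openin X {x \<in> topspace X. orbit K \<phi> x \<in> S \<inter> T}"
      using openin_Int[OF conjunct2[OF S] conjunct2[OF T]] by (simp only:)
  next
    fix \<U>
    assume U: "\<forall>S\<in>\<U>. S \<subseteq> orbits K (topspace X) \<phi> \<and> openin X {x \<in> topspace X. orbit K \<phi> x \<in> S}"
    then show "\<Union>\<U> \<subseteq> orbits K (topspace X) \<phi>"
      by blast
    have "{x \<in> topspace X. orbit K \<phi> x \<in> \<Union>\<U>} =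
          (\<Union>S\<in>\<U>. {x \<in> topspace X. orbit K \<phi> x \<in> S})"
      by blast
    moreover have "openin X (\<Union>S\<in>\<U>. {x \<in> topspace X. orbit K \<phi> x \<in> S})"
      using U by (intro openin_Union) blast
    ultimately show "openin X {x \<in> topspace X. orbit K \<phi> x \<in> \<Union>\<U>}"
      by (simp only:)
  qed
  then show ?thesis
    unfolding orbit_space_def by (simp only: topology_inverse')
qed

lemma topspace_orbit_space: "topspace (orbit_space K X \<phi>) = orbits K (topspace X) \<phi>"
proof
  show "topspace (orbit_space K X \<phi>) \<subseteq> orbits K (topspace X) \<phi>"
    using openin_orbit_space openin_topspace by blast
  have "{x \<in> topspace X. orbit K \<phi> x \<in> orbits K (topspace X) \<phi>} = topspace X"
    unfolding orbits_def by blast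
  then have "openin (orbit_space K X \<phi>) (orbits K (topspace X) \<phi>)"
    by (simp add: openin_orbit_space)
  then show "orbits K (topspace X) \<phi> \<subseteq> topspace (orbit_space K X \<phi>)"
    by (rule openin_subset)
qed

lemma quotient_map_orbit: "quotient_map X (orbit_space K X \<phi>) (orbit K \<phi>)"
  unfolding quotient_map_def topspace_orbit_space
  by (auto simp: openin_orbit_space orbits_def)

text \<open>A \<open>K\<close>-equivariant homeomorphism over \<open>U\<close> from the preimage of \<open>U\<close> onto \<open>K \<times> U\<close>,
  where \<open>K\<close> acts on \<open>K \<times> U\<close> by left translation of the first factor.\<close>

definition local_trivialization ::
    "('g, 'b) monoid_scheme \<Rightarrow> 'g topology \<Rightarrow> 'x topology \<Rightarrow> ('g \<Rightarrow> 'x \<Rightarrow> 'x) \<Rightarrow>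
     'x set set \<Rightarrow> ('x \<Rightarrow> 'g \<times> 'x set) \<Rightarrow> bool" where
  "local_trivialization K T X \<phi> U f \<longleftrightarrow>
     (let P = {x \<in> topspace X. orbit K \<phi> x \<in> U} in
        homeomorphic_map (subtopology X P)
                         (prod_topology T (subtopology (orbit_space K X \<phi>) U)) f \<and>
        (\<forall>x\<in>P. snd (f x) = orbit K \<phi> x) \<and>
        (\<forall>k\<in>carrier K. \<forall>x\<in>P. f (\<phi> k x) = (k \<otimes>\<^bsub>K\<^esub> fst (f x), snd (f x))))"

definition principal_action ::
    "('g, 'b) monoid_scheme \<Rightarrow> 'g topology \<Rightarrow> 'x topology \<Rightarrow> ('g \<Rightarrow> 'x \<Rightarrow> 'x) \<Rightarrow> bool" where
  "principal_action K T X \<phi> \<longleftrightarrow>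
     (\<forall>p \<in> topspace (orbit_space K X \<phi>).
        \<exists>U f. openin (orbit_space K X \<phi>) U \<and> p \<in> U \<and> local_trivialization K T X \<phi> U f)"

end

theory Submission
  imports Defs
begin

text \<open>A free action of \<open>K\<close> on \<open>X\<close> is principal iff \<open>X\<close> is covered by open invariant sets carrying
  continuous equivariant maps to \<open>K\<close>. If the restriction to \<open>H\<close> of a free \<open>G\<close>-action has such charts,
  compactness provides an \<open>H\<close>-invariant neighbourhood \<open>W\<close> of any point with \<open>g W \<inter> W = \<emptyset>\<close> for
  \<open>g \<notin> H\<close>, and a chart on \<open>W\<close> extends equivariantly to \<open>G W\<close>. Conversely, an \<open>H\<close>-space \<open>X\<close> embeds
  equivariantly in the induced \<open>G\<close>-space \<open>G \<times>\<^sub>H X\<close>, topologically a finite disjoint union of copies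
  of \<open>X\<close>, and charts pull back along this embedding, since \<open>G\<close> maps continuously and left
  \<open>H\<close>-equivariantly to \<open>H\<close>.\<close>

section \<open>Topological groups and their continuous actions\<close>

locale top_group =
  fixes G :: "('g, 'b) monoid_scheme" (structure) and T :: "'g topology"
  assumes tg: "topological_group G T"
begin

sublocale group G
  using tg by (simp add: topological_group_def)

lemma topspace_group: "topspace T = carrier G"
  using tg by (simp add: topological_group_def)

lemma continuous_map_mult:
  assumes "continuous_map Z T a" "continuous_map Z T b"
  shows "continuous_map Z T (\<lambda>z. a z \<otimes> b z)"
proof -
  have "continuous_map (prod_topology T T) T (\<lambda>(g, h). g \<otimes> h)"
    using tg by (simp add: topological_group_def)
  from continuous_map_compose[OF continuous_map_pairedI[OF assms] this] show ?thesis
    by (simp add: comp_def)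
qed

lemma continuous_map_m_inv:
  assumes "continuous_map Z T a"
  shows "continuous_map Z T (\<lambda>z. inv (a z))"
  using continuous_map_compose[OF assms, of T "\<lambda>g. inv g"] tg
  by (simp add: topological_group_def comp_def)

end

locale top_group_action = top_group G T
  for G :: "('g, 'b) monoid_scheme" (structure) and T :: "'g topology" +
  fixes X :: "'x topology" and \<phi> :: "'g \<Rightarrow> 'x \<Rightarrow> 'x"
  assumes ca: "continuous_action G T X \<phi>"
begin

sublocale act: group_action G "topspace X" \<phi>
  using ca by (simp add: continuous_action_def)

lemma act_closed [simp]: "k \<in> carrier G \<Longrightarrow> x \<in> topspace X \<Longrightarrow> \<phi> k x \<in> topspace X"
  using act.element_image by blast

lemma act_one [simp]: "x \<in> topspace X \<Longrightarrow> \<phi> \<one> x = x"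
  by (metis act.id_eq_one restrict_apply')

lemma act_mult:
  "g \<in> carrier G \<Longrightarrow> h \<in> carrier G \<Longrightarrow> x \<in> topspace X \<Longrightarrow> \<phi> (g \<otimes> h) x = \<phi> g (\<phi> h x)"
  by (rule act.composition_rule)

lemma act_inv_cancel [simp]:
  assumes "g \<in> carrier G" "x \<in> topspace X"
  shows "\<phi> (inv g) (\<phi> g x) = x" "\<phi> g (\<phi> (inv g) x) = x"
  using assms by (simp_all flip: act_mult)

lemma continuous_map_act:
  assumes "continuous_map Z T a" "continuous_map Z X b"
  shows "continuous_map Z X (\<lambda>z. \<phi> (a z) (b z))"
proof -
  have "continuous_map (prod_topology T X) X (\<lambda>(k, x). \<phi> k x)"
    using ca by (simp add: continuous_action_def)
  from continuous_map_compose[OF continuous_map_pairedI[OF assms] this] show ?thesis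
    by (simp add: comp_def)
qed

lemma orbit_act:
  assumes "k \<in> carrier G" "x \<in> topspace X"
  shows "orbit G \<phi> (\<phi> k x) = orbit G \<phi> x"
proof -
  have "\<phi> g (\<phi> k x) \<in> orbit G \<phi> x" if "g \<in> carrier G" for g
    using that assms by (auto simp: orbit_def intro!: exI[of _ "g \<otimes> k"] simp: act_mult)
  moreover have "\<phi> g x \<in> orbit G \<phi> (\<phi> k x)" if "g \<in> carrier G" for g
    using that assms by (auto simp: orbit_def intro!: exI[of _ "g \<otimes> inv k"] simp: act_mult)
  ultimately show ?thesis
    by (auto simp: orbit_def)
qed

lemma orbit_eqD:
  assumes "x \<in> topspace X" "y \<in> topspace X" "orbit G \<phi> x = orbit G \<phi> y"
  obtains k where "k \<in> carrier G" "y = \<phi> k x"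
  using act.orbit_refl[OF assms(2)] assms(3) by (auto simp: orbit_def)

end

section \<open>Principality in terms of equivariant charts\<close>

text \<open>An equivariant map \<open>f\<close> to the group plays the role of the first component
  of a trivialization over the orbits in \<open>P\<close>. The second component is always the orbit
  map, and the homeomorphism property follows (see \<open>charts_imp_principal\<close>), so charts
  can be handled without the orbit space. Equivariance also forces freeness on \<open>P\<close>:
  \<open>\<phi> k y = y\<close> gives \<open>f y = k \<otimes> f y\<close>.\<close>

definition equivariant_chart where
  "equivariant_chart G T X \<phi> P f \<longleftrightarrow>
     openin X P \<and> (\<forall>k\<in>carrier G. \<forall>y\<in>P. \<phi> k y \<in> P) \<and>
     continuous_map (subtopology X P) T f \<and>
     (\<forall>k\<in>carrier G. \<forall>y\<in>P. f (\<phi> k y) = k \<otimes>\<^bsub>G\<^esub> f y)"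

definition has_equivariant_charts where
  "has_equivariant_charts G T X \<phi> \<longleftrightarrow>
     (\<forall>x\<in>topspace X. \<exists>P f. x \<in> P \<and> equivariant_chart G T X \<phi> P f)"

context top_group_action
begin

text \<open>The first component of a trivialization over \<open>U\<close> is a chart on the preimage
  of \<open>U\<close>, which is invariant because it is a union of orbits.\<close>

lemma principal_imp_charts:
  assumes "principal_action G T X \<phi>"
  shows "has_equivariant_charts G T X \<phi>"
  unfolding has_equivariant_charts_def
proof
  fix x assume x: "x \<in> topspace X"
  then have "orbit G \<phi> x \<in> topspace (orbit_space G X \<phi>)"
    by (auto simp: topspace_orbit_space orbits_def)
  then obtain U f where U: "openin (orbit_space G X \<phi>) U" "orbit G \<phi> x \<in> U"
    and f: "local_trivialization G T X \<phi> U f"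
    using assms by (auto simp: principal_action_def)
  define P where "P = {x \<in> topspace X. orbit G \<phi> x \<in> U}"
  have hom: "homeomorphic_map (subtopology X P) (prod_topology T (subtopology (orbit_space G X \<phi>) U)) f"
    and eq: "\<And>k y. k \<in> carrier G \<Longrightarrow> y \<in> P \<Longrightarrow> f (\<phi> k y) = (k \<otimes> fst (f y), snd (f y))"
    using f by (auto simp: local_trivialization_def Let_def P_def)
  have "continuous_map (subtopology X P) T (fst \<circ> f)"
    by (rule continuous_map_fst_of[OF homeomorphic_imp_continuous_map[OF hom]])
  then have "equivariant_chart G T X \<phi> P (fst \<circ> f)"
    using U(1) eq by (auto simp: equivariant_chart_def openin_orbit_space P_def orbit_act)
  then show "\<exists>P f. x \<in> P \<and> equivariant_chart G T X \<phi> P f"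
    using x U(2) by (intro exI[of _ P] exI[of _ "fst \<circ> f"]) (simp add: P_def)
qed

text \<open>The map \<open>y \<mapsto> f(y)\<^sup>-\<^sup>1 y\<close> is constant on orbits, hence descends to a continuous local section
  of the orbit map; the inverse of the trivialization is \<open>(k, p) \<mapsto> k s(p)\<close>.\<close>

lemma charts_imp_principal:
  assumes "has_equivariant_charts G T X \<phi>"
  shows "principal_action G T X \<phi>"
  unfolding principal_action_def
proof
  fix p assume "p \<in> topspace (orbit_space G X \<phi>)"
  then obtain x where x: "x \<in> topspace X" "p = orbit G \<phi> x"
    by (auto simp: topspace_orbit_space orbits_def)
  then obtain P f where xP: "x \<in> P" and ch: "equivariant_chart G T X \<phi> P f"
    using assms by (auto simp: has_equivariant_charts_def)
  then have P: "openin X P" and inv: "\<And>k y. k \<in> carrier G \<Longrightarrow> y \<in> P \<Longrightarrow> \<phi> k y \<in> P"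
    and cf: "continuous_map (subtopology X P) T f"
    and eq: "\<And>k y. k \<in> carrier G \<Longrightarrow> y \<in> P \<Longrightarrow> f (\<phi> k y) = k \<otimes> f y"
    by (auto simp: equivariant_chart_def)
  have PX: "\<And>y. y \<in> P \<Longrightarrow> y \<in> topspace X"
    using P openin_subset by blast
  have fG: "f y \<in> carrier G" if "y \<in> P" for y
    using continuous_map_funspace[OF cf] that PX by (auto simp: topspace_group)
  define q where "q = orbit G \<phi>"
  define U where "U = q ` P"
  \<comment> \<open>\<open>P\<close> is invariant, hence a union of orbits, so it is the full
    preimage of its image \<open>U\<close>.\<close>
  have pre: "{x \<in> topspace X. q x \<in> U} = P"
  proof -
    have "y \<in> P" if "y \<in> topspace X" "z \<in> P" "q y = q z" for y z
      using orbit_eqD[of z y] that PX inv by (metis q_def)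
    then show ?thesis
      using PX by (auto simp: U_def)
  qed
  have U: "openin (orbit_space G X \<phi>) U"
    using P pre PX by (auto simp: openin_orbit_space U_def orbits_def q_def)
  \<comment> \<open>A quotient map restricted to the preimage of an open set is again a quotient
    map, so continuity of maps out of \<open>U\<close> can be tested on \<open>P\<close>.\<close>
  have qm: "quotient_map (subtopology X P) (subtopology (orbit_space G X \<phi>) U) q"
    by (intro quotient_map_restriction[OF _ pre] disjI1 U) (simp add: q_def quotient_map_orbit)
  define s where "s = (\<lambda>o'. let y = (SOME y. y \<in> P \<and> q y = o') in \<phi> (inv (f y)) y)"
  have sq: "s (q y) = \<phi> (inv (f y)) y" if y: "y \<in> P" for y
  proof -
    define z where "z = (SOME z. z \<in> P \<and> q z = q y)"
    have z: "z \<in> P" "q z = q y"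
      using someI[of "\<lambda>z. z \<in> P \<and> q z = q y" y] y by (auto simp: z_def)
    then obtain k where k: "k \<in> carrier G" "z = \<phi> k y"
      using orbit_eqD[of y z] PX y by (auto simp: q_def)
    \<comment> \<open>With \<open>z = \<phi> k y\<close>, equivariance turns
      \<open>inv (f z)\<close> into \<open>inv (f y) \<otimes> inv k\<close>, and \<open>k\<close>
      cancels: the chosen representative does not matter.\<close>
    have "\<phi> (inv (f z)) z = \<phi> (inv (f y) \<otimes> inv k) (\<phi> k y)"
      using k y by (simp add: eq inv_mult_group fG)
    also have "\<dots> = \<phi> (inv (f y)) y"
      using k y by (simp add: fG PX act_mult)
    finally show ?thesis
      by (simp add: s_def z_def Let_def)
  qed
  have idP: "continuous_map (subtopology X P) X (\<lambda>y. y)"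
    by (simp add: continuous_map_from_subtopology)
  have "continuous_map (subtopology X P) X (\<lambda>y. \<phi> (inv (f y)) y)"
    by (intro continuous_map_act continuous_map_m_inv cf idP)
  then have "continuous_map (subtopology X P) X (s \<circ> q)"
    by (rule continuous_map_eq) (auto simp: sq)
  then have cs: "continuous_map (subtopology (orbit_space G X \<phi>) U) X s"
    by (rule continuous_compose_quotient_map[OF qm])
  let ?Y = "prod_topology T (subtopology (orbit_space G X \<phi>) U)"
  define F where "F = (\<lambda>y. (f y, q y))"
  define F' where "F' = (\<lambda>z. \<phi> (fst z) (s (snd z)))"
  have tU: "topspace (subtopology (orbit_space G X \<phi>) U) = U"
    using U openin_subset by (metis topspace_subtopology_subset)
  have tP: "topspace (subtopology X P) = P"
    using PX by auto
  have sP: "s u \<in> P" if "u \<in> U" for u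
    using that inv fG by (auto simp: U_def sq)
  have "homeomorphic_maps (subtopology X P) ?Y F F'"
    unfolding homeomorphic_maps_def
  proof (intro conjI ballI)
    show "continuous_map (subtopology X P) ?Y F"
      unfolding F_def by (intro continuous_map_pairedI cf quotient_imp_continuous_map qm)
    have "continuous_map ?Y X (\<lambda>z. \<phi> (fst z) (s (snd z)))"
      using continuous_map_compose[OF continuous_map_snd cs]
      by (intro continuous_map_act continuous_map_fst) (simp add: comp_def)
    then show "continuous_map ?Y (subtopology X P) F'"
      by (auto simp: continuous_map_in_subtopology F'_def tU topspace_group intro!: inv sP)
    show "F' (F y) = y" if "y \<in> topspace (subtopology X P)" for y
      using that fG PX by (auto simp: F'_def F_def sq simp flip: act_mult)
    show "F (F' z) = z" if zY: "z \<in> topspace ?Y" for z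
    proof -
      obtain k y where z: "z = (k, q y)" "k \<in> carrier G" "y \<in> P"
        using zY tU by (auto simp: topspace_group U_def)
      \<comment> \<open>The section takes its values where \<open>f\<close> equals
        \<open>\<one>\<close>, so \<open>f\<close> recovers \<open>k\<close> from
        \<open>\<phi> k (s u)\<close>.\<close>
      have "f (\<phi> (inv (f y)) y) = \<one>" "q (\<phi> (inv (f y)) y) = q y"
        using z fG PX by (auto simp: eq q_def orbit_act)
      then show ?thesis
        using z fG PX inv by (simp add: F_def F'_def sq eq) (simp add: q_def orbit_act)
    qed
  qed
  then have "homeomorphic_map (subtopology X P) ?Y F"
    by (auto simp: homeomorphic_map_maps)
  then have "local_trivialization G T X \<phi> U F"
    unfolding local_trivialization_def Let_def q_def[symmetric] pre
    using PX by (simp add: F_def eq) (simp add: q_def orbit_act)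
  then show "\<exists>U f. openin (orbit_space G X \<phi>) U \<and> p \<in> U \<and> local_trivialization G T X \<phi> U f"
    using U x xP by (auto simp: U_def q_def)
qed

end

section \<open>Open cosets and continuous coset representatives\<close>

locale closed_finite_index = top_group G T
  for G :: "('g, 'b) monoid_scheme" (structure) and T :: "'g topology" +
  fixes H :: "'g set"
  assumes sub: "subgroup H G" and clo: "closedin T H" and fin: "finite (rcosets H)"
begin

lemma H_carrier: "h \<in> H \<Longrightarrow> h \<in> carrier G"
  using sub subgroup.mem_carrier by metis

text \<open>Right translation by \<open>inv a\<close> carries the coset to \<open>H\<close>; as a
  preimage under a continuous map, the coset inherits closedness and openness from
  \<open>H\<close>.\<close>

lemma rcoset_eq_vimage:
  assumes "a \<in> carrier G"
  shows "H #> a = {g \<in> topspace T. g \<otimes> inv a \<in> H}"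
proof -
  have "g \<in> H #> a" if "g \<in> carrier G" "g \<otimes> inv a \<in> H" for g
    using that assms by (auto simp: r_coset_def m_assoc intro!: bexI[of _ "g \<otimes> inv a"])
  then show ?thesis
    using assms H_carrier by (auto simp: r_coset_def topspace_group m_assoc)
qed

lemma continuous_map_rmult: "a \<in> carrier G \<Longrightarrow> continuous_map T T (\<lambda>g. g \<otimes> a)"
  by (intro continuous_map_mult) (auto simp: topspace_group)

text \<open>The complement of \<open>H\<close> is the union of the other right cosets, which are
  finitely many closed sets.\<close>

lemma openin_subgroup: "openin T H"
proof -
  have "closedin T C" if C: "C \<in> rcosets H" for C
  proof -
    obtain a where a: "a \<in> carrier G" "C = H #> a"
      using C by (auto simp: RCOSETS_def)
    then show ?thesis
      unfolding a(2) rcoset_eq_vimage[OF a(1)]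
      by (intro closedin_continuous_map_preimage[OF continuous_map_rmult clo]) auto
  qed
  then have "closedin T (\<Union>(rcosets H - {H}))"
    using fin by (intro closedin_Union) auto
  moreover have "topspace T - H = \<Union>(rcosets H - {H})"
  proof -
    have "H \<in> rcosets H"
      using coset_mult_one[of H] rcosetsI[of H "\<one>"] sub by (simp add: subgroup.subset)
    then have "C \<inter> H = {}" if "C \<in> rcosets H - {H}" for C
      using rcos_disjoint[OF sub] that by (auto simp: pairwise_def disjnt_def)
    then show ?thesis
      using rcosets_part_G[OF sub] by (auto simp: topspace_group)
  qed
  ultimately show ?thesis
    using H_carrier by (auto simp: openin_closedin_eq topspace_group)
qed

lemma openin_rcoset:
  assumes "a \<in> carrier G"
  shows "openin T (H #> a)"
  unfolding rcoset_eq_vimage[OF assms]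
  using assms by (intro openin_continuous_map_preimage[OF continuous_map_rmult openin_subgroup]) auto

text \<open>Every \<open>g\<close> is \<open>r \<otimes> h\<close> with \<open>r\<close> the chosen
  representative of the left coset \<open>gH\<close> and \<open>h\<close> in \<open>H\<close>.
  Cosets are open, so \<open>r\<close> is locally constant in \<open>g\<close> and both factors are
  continuous. The factor \<open>\<eta>\<close> later yields an equivariant map from \<open>G\<close>
  to \<open>H\<close>, and both factors together yield the induced action.\<close>

lemma coset_decomposition:
  obtains \<rho> \<eta> where
    "continuous_map T (discrete_topology (\<rho> ` carrier G)) \<rho>"
    "continuous_map T (subtopology T H) \<eta>"
    "finite (\<rho> ` carrier G)"
    "\<And>g. g \<in> carrier G \<Longrightarrow> \<rho> g \<in> carrier G"
    "\<And>g. g \<in> carrier G \<Longrightarrow> \<rho> g \<otimes> \<eta> g = g"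
    "\<And>g h. g \<in> carrier G \<Longrightarrow> h \<in> H \<Longrightarrow> \<rho> (g \<otimes> h) = \<rho> g"
    "\<And>g h. g \<in> carrier G \<Longrightarrow> h \<in> H \<Longrightarrow> \<eta> (g \<otimes> h) = \<eta> g \<otimes> h"
proof -
  define c where "c C = (SOME r. r \<in> C)" for C :: "'g set"
  \<comment> \<open>Inversion exchanges \<open>gH\<close> with the right coset of
    \<open>inv g\<close>, so the inverse of a representative of the latter represents
    \<open>gH\<close>.\<close>
  define \<rho> where "\<rho> g = inv (c (H #> inv g))" for g
  define \<eta> where "\<eta> g = c (H #> inv g) \<otimes> g" for g
  have c: "c (H #> g) \<in> H #> g" if "g \<in> carrier G" for g
    unfolding c_def using rcos_self[OF that sub] by (rule someI)
  have cG: "c (H #> g) \<in> carrier G" if "g \<in> carrier G" for g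
    using c[OF that] rcoset_eq_vimage[OF that] by (auto simp: topspace_group)
  have shift: "H #> inv (g \<otimes> h) = H #> inv g" if "g \<in> carrier G" "h \<in> H" for g h
    using that sub coset_mult_assoc[of H "inv h" "inv g"] coset_join2[of "inv h" H] H_carrier
    by (simp add: inv_mult_group subgroup.m_inv_closed subgroup.subset)
  have cont: "continuous_map T (discrete_topology (\<rho> ` carrier G)) \<rho>"
    unfolding continuous_map_def
  proof (intro conjI allI impI)
    show "\<rho> \<in> topspace T \<rightarrow> topspace (discrete_topology (\<rho> ` carrier G))"
      by (auto simp: topspace_group)
    fix U
    \<comment> \<open>\<open>\<rho>\<close> is constant on each set of those \<open>g\<close> whose
      inverse lies in a fixed right coset, so every preimage is a union of such open sets.\<close>
    have "{g \<in> topspace T. \<rho> g \<in> U} =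
          (\<Union>a\<in>{a \<in> carrier G. \<rho> a \<in> U}. {g \<in> topspace T. inv g \<in> H #> inv a})"
    proof -
      have eq: "\<rho> g = \<rho> a" if "g \<in> carrier G" "a \<in> carrier G" "inv g \<in> H #> inv a" for g a
        using repr_independence[OF that(3)] sub that by (simp add: \<rho>_def)
      have self: "inv g \<in> H #> inv g" if "g \<in> carrier G" for g
        using that rcos_self[OF _ sub] by simp
      show ?thesis
      proof (intro equalityI subsetI)
        fix g assume "g \<in> {g \<in> topspace T. \<rho> g \<in> U}"
        then show "g \<in> (\<Union>a\<in>{a \<in> carrier G. \<rho> a \<in> U}. {g \<in> topspace T. inv g \<in> H #> inv a})"
          using self[of g] unfolding topspace_group by blast
      next
        fix g assume "g \<in> (\<Union>a\<in>{a \<in> carrier G. \<rho> a \<in> U}. {g \<in> topspace T. inv g \<in> H #> inv a})"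
        then obtain a where "a \<in> carrier G" "\<rho> a \<in> U" "g \<in> carrier G" "inv g \<in> H #> inv a"
          unfolding topspace_group by blast
        then show "g \<in> {g \<in> topspace T. \<rho> g \<in> U}"
          using eq[of g a] by (simp add: topspace_group)
      qed
    qed
    moreover have "openin T {g \<in> topspace T. inv g \<in> H #> inv a}" if "a \<in> carrier G" for a
      using that by (intro openin_continuous_map_preimage[OF _ openin_rcoset] continuous_map_m_inv) auto
    ultimately show "openin T {g \<in> topspace T. \<rho> g \<in> U}"
      by auto
  qed
  have \<rho>G: "\<rho> g \<in> carrier G" if "g \<in> carrier G" for g
    using that cG by (simp add: \<rho>_def)
  have "continuous_map (discrete_topology (\<rho> ` carrier G)) T (\<lambda>r. r)"
    using \<rho>G by (auto simp: topspace_group)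
  then have "continuous_map T T \<rho>"
    using continuous_map_compose[OF cont] by (simp add: comp_def)
  \<comment> \<open>Solving \<open>\<rho> g \<otimes> \<eta> g = g\<close> for
    \<open>\<eta> g\<close> reduces its continuity to that of \<open>\<rho>\<close>.\<close>
  then have "continuous_map T T (\<lambda>g. inv (\<rho> g) \<otimes> g)"
    by (intro continuous_map_mult continuous_map_m_inv) auto
  then have "continuous_map T T \<eta>"
    by (rule continuous_map_eq) (auto simp: topspace_group \<rho>_def \<eta>_def cG)
  moreover have "\<eta> g \<in> H" if "g \<in> carrier G" for g
    using c[of "inv g"] that rcoset_eq_vimage[of "inv g"] by (auto simp: \<eta>_def)
  ultimately have "continuous_map T (subtopology T H) \<eta>"
    by (auto simp: continuous_map_in_subtopology topspace_group)
  moreover have "\<rho> ` carrier G \<subseteq> (\<lambda>C. inv (c C)) ` (rcosets H)"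
    by (auto simp: \<rho>_def RCOSETS_def)
  then have "finite (\<rho> ` carrier G)"
    using fin finite_surj by blast
  moreover have "\<rho> g \<otimes> \<eta> g = g" if "g \<in> carrier G" for g
    using that cG[of "inv g"] by (simp add: \<rho>_def \<eta>_def flip: m_assoc)
  moreover have "\<rho> (g \<otimes> h) = \<rho> g" "\<eta> (g \<otimes> h) = \<eta> g \<otimes> h" if "g \<in> carrier G" "h \<in> H" for g h
    using that cG[of "inv g"] H_carrier by (simp_all add: \<rho>_def \<eta>_def shift m_assoc)
  ultimately show ?thesis
    by (intro that[of \<rho> \<eta>] cont \<rho>G)
qed

lemma top_group_subgroup: "top_group (G\<lparr>carrier := H\<rparr>) (subtopology T H)"
proof
  have eq: "inv\<^bsub>G\<lparr>carrier := H\<rparr>\<^esub> h = inv h" if "h \<in> H" for h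
    using that sub by (simp add: m_inv_consistent)
  have 1: "continuous_map (subtopology T H) T (\<lambda>g. inv g)"
    by (intro continuous_map_m_inv) (auto simp: continuous_map_from_subtopology)
  have 2: "continuous_map (subtopology T H) (subtopology T H) (\<lambda>g. inv\<^bsub>G\<lparr>carrier := H\<rparr>\<^esub> g)"
    unfolding continuous_map_in_subtopology
    using sub by (auto intro!: continuous_map_eq[OF 1] simp: eq subgroup.m_inv_closed)
  have "continuous_map (prod_topology (subtopology T H) (subtopology T H)) T (\<lambda>z. fst z \<otimes> snd z)"
    by (intro continuous_map_mult) 
      (metis continuous_map_fst continuous_map_snd continuous_map_in_subtopology)+
  then have 3: "continuous_map (prod_topology (subtopology T H) (subtopology T H)) (subtopology T H)
         (\<lambda>(g, h). g \<otimes> h)"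
    unfolding continuous_map_in_subtopology
    using sub by (auto simp: case_prod_beta' subgroup.m_closed)
  show "topological_group (G\<lparr>carrier := H\<rparr>) (subtopology T H)"
    using 2 3 sub subgroup.subgroup_is_group[OF sub is_group] H_carrier
    by (auto simp: topological_group_def topspace_group)
qed

end

section \<open>From the subgroup to the group: slices and extension of charts\<close>

text \<open>The complement is the projection to \<open>X\<close> of the closed set of pairs
  \<open>(k, x)\<close> with \<open>k\<close> in \<open>C\<close> and \<open>\<phi> k x\<close>
  outside \<open>A\<close>, and projection along a compact factor is a closed map.\<close>

lemma (in top_group_action) openin_tube:
  assumes "compactin T C" "openin X A"
  shows "openin X {x \<in> topspace X. \<forall>k\<in>C. \<phi> k x \<in> A}"
proof -
  let ?Z = "prod_topology (subtopology T C) X"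
  have C: "C \<subseteq> carrier G"
    using assms(1) compactin_subset_topspace topspace_group by blast
  have "closed_map ?Z X snd"
    using assms(1) by (intro closed_map_snd) (simp add: compact_space_subtopology)
  moreover have "continuous_map ?Z X (\<lambda>z. \<phi> (fst z) (snd z))"
    by (intro continuous_map_act) (metis continuous_map_fst continuous_map_snd continuous_map_in_subtopology)+
  then have "closedin ?Z {z \<in> topspace ?Z. \<phi> (fst z) (snd z) \<in> topspace X - A}"
    by (rule closedin_continuous_map_preimage) (use assms in auto)
  ultimately have "closedin X (snd ` {z \<in> topspace ?Z. \<phi> (fst z) (snd z) \<in> topspace X - A})"
    by (auto simp: closed_map_def)
  then have "openin X (topspace X - snd ` {z \<in> topspace ?Z. \<phi> (fst z) (snd z) \<in> topspace X - A})"
    by auto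
  moreover have "topspace X - snd ` {z \<in> topspace ?Z. \<phi> (fst z) (snd z) \<in> topspace X - A} =
     {x \<in> topspace X. \<forall>k\<in>C. \<phi> k x \<in> A}"
  proof -
    have "x \<in> snd ` {z \<in> topspace ?Z. \<phi> (fst z) (snd z) \<in> topspace X - A}"
      if "x \<in> topspace X" "k \<in> C" "\<phi> k x \<notin> A" for x k
      using that C by (intro image_eqI[of _ _ "(k, x)"]) (auto simp: topspace_group)
    then show ?thesis
      by auto
  qed
  ultimately show ?thesis
    by simp
qed


lemma (in closed_finite_index) free_continuous_action_restrict:
  assumes "free_continuous_action G T X \<phi>"
  shows "free_continuous_action (G\<lparr>carrier := H\<rparr>) (subtopology T H) X \<phi>"
proof -
  interpret top_group_action G T X \<phi>
    using assms by unfold_locales (simp add: free_continuous_action_def)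
  have "continuous_map (prod_topology (subtopology T H) X) X (\<lambda>z. \<phi> (fst z) (snd z))"
    by (intro continuous_map_act)
      (metis continuous_map_fst continuous_map_snd continuous_map_in_subtopology)+
  moreover have "stabilizer (G\<lparr>carrier := H\<rparr>) \<phi> x = {\<one>}" if "x \<in> topspace X" for x
  proof -
    have "stabilizer (G\<lparr>carrier := H\<rparr>) \<phi> x = stabilizer G \<phi> x \<inter> H"
      using H_carrier by (auto simp: stabilizer_def)
    then show ?thesis
      using assms that subgroup.one_closed[OF sub] by (auto simp: free_continuous_action_def)
  qed
  ultimately show ?thesis
    using act.induced_action[OF sub]
    by (simp add: free_continuous_action_def continuous_action_def case_prod_beta')
qed

locale subgroup_of_action = closed_finite_index G T H + top_group_action G T X \<phi>
  for G :: "('g, 'b) monoid_scheme" (structure) and T :: "'g topology" and H :: "'g set"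
    and X :: "'x topology" and \<phi> :: "'g \<Rightarrow> 'x \<Rightarrow> 'x" +
  assumes compT: "compact_space T" and hausX: "Hausdorff_space X"
    and free: "\<And>g x. x \<in> topspace X \<Longrightarrow> g \<in> carrier G \<Longrightarrow> \<phi> g x = x \<Longrightarrow> g = \<one>"
begin

text \<open>By freeness the compact sets \<open>Hx\<close> and \<open>(G - H)x\<close> are disjoint,
  so they have disjoint open neighbourhoods \<open>A\<close> and \<open>B\<close>. The points that
  \<open>H\<close> sends into \<open>A\<close> and \<open>G - H\<close> sends into \<open>B\<close>
  form an open set by \<open>openin_tube\<close>.\<close>

lemma slice_neighbourhood:
  assumes x: "x \<in> topspace X"
  obtains V where "openin X V" "x \<in> V" "\<And>h y. h \<in> H \<Longrightarrow> y \<in> V \<Longrightarrow> \<phi> h y \<in> V"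
    "\<And>g y. g \<in> carrier G \<Longrightarrow> y \<in> V \<Longrightarrow> \<phi> g y \<in> V \<Longrightarrow> g \<in> H"
proof -
  let ?C = "carrier G - H"
  have cH: "compactin T H"
    by (rule closedin_compact_space[OF compT clo])
  \<comment> \<open>\<open>H\<close> is open, so its complement is closed and therefore
    compact.\<close>
  have cC: "compactin T ?C"
    using openin_subgroup by (intro closedin_compact_space[OF compT]) (auto simp flip: topspace_group)
  have "continuous_map T X (\<lambda>g. \<phi> g x)"
    using x by (intro continuous_map_act) auto
  then have "compactin X ((\<lambda>g. \<phi> g x) ` H)" "compactin X ((\<lambda>g. \<phi> g x) ` ?C)"
    using cH cC image_compactin by blast+
  moreover have "disjnt ((\<lambda>g. \<phi> g x) ` H) ((\<lambda>g. \<phi> g x) ` ?C)"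
  proof -
    have False if "h \<in> H" "g \<in> carrier G" "g \<notin> H" "\<phi> h x = \<phi> g x" for h g
    proof -
      have h: "h \<in> carrier G"
        using that H_carrier by blast
      have "\<phi> (inv g \<otimes> h) x = x"
        using that h x by (simp add: act_mult)
      then have "inv g \<otimes> h = \<one>"
        using free x that h by blast
      then have "g = h"
        using h that by (metis inv_equality inv_closed inv_inv)
      then show False
        using that by blast
    qed
    then show ?thesis
      by (auto simp: disjnt_def)
  qed
  ultimately obtain A B where AB: "openin X A" "openin X B" "(\<lambda>g. \<phi> g x) ` H \<subseteq> A"
      "(\<lambda>g. \<phi> g x) ` ?C \<subseteq> B" "disjnt A B"
    using Hausdorff_space_compact_separation[OF hausX] by metis
  define V where "V = {y \<in> topspace X. \<forall>k\<in>H. \<phi> k y \<in> A} \<inter> {y \<in> topspace X. \<forall>k\<in>?C. \<phi> k y \<in> B}"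
  have "openin X V"
    unfolding V_def using cH cC AB by (intro openin_Int openin_tube)
  moreover have "x \<in> V"
    using AB x by (auto simp: V_def)
  \<comment> \<open>Right multiplication by an element of \<open>H\<close> preserves both
    \<open>H\<close> and its complement, so both conditions defining \<open>V\<close> pass from
    \<open>y\<close> to \<open>\<phi> h y\<close>.\<close>
  moreover have "\<phi> h y \<in> V" if h: "h \<in> H" and y: "y \<in> V" for h y
  proof -
    have hG: "h \<in> carrier G" and yX: "y \<in> topspace X"
      using h y H_carrier by (auto simp: V_def)
    have "\<phi> k (\<phi> h y) \<in> A" if "k \<in> H" for k
    proof -
      have "k \<otimes> h \<in> H"
        using subgroup.m_closed[OF sub that h] .
      then show ?thesis
        using y that H_carrier hG yX by (auto simp: V_def simp flip: act_mult)
    qed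
    moreover have "\<phi> k (\<phi> h y) \<in> B" if "k \<in> ?C" for k
    proof -
      have "k \<otimes> h \<notin> H"
      proof
        assume "k \<otimes> h \<in> H"
        then have "k \<otimes> h \<otimes> inv h \<in> H"
          using subgroup.m_closed[OF sub] subgroup.m_inv_closed[OF sub h] by blast
        then show False
          using that hG by (simp add: m_assoc)
      qed
      then show ?thesis
        using y that hG yX by (auto simp: V_def simp flip: act_mult)
    qed
    ultimately show ?thesis
      using hG yX by (auto simp: V_def)
  qed
  \<comment> \<open>The first condition at \<open>k = \<one>\<close> shows that \<open>V\<close>
    lies in \<open>A\<close>, whereas an element \<open>g\<close> outside \<open>H\<close> would
    send \<open>y\<close> into \<open>B\<close>.\<close>
  moreover have "g \<in> H" if "g \<in> carrier G" "y \<in> V" "\<phi> g y \<in> V" for g y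
  proof (rule ccontr)
    assume "g \<notin> H"
    then have "\<phi> g y \<in> B"
      using that by (auto simp: V_def)
    moreover have "\<phi> \<one> (\<phi> g y) \<in> A"
      using that subgroup.one_closed[OF sub] by (auto simp: V_def)
    ultimately show False
      using that AB by (auto simp: V_def disjnt_def)
  qed
  ultimately show ?thesis
    using that by blast
qed

text \<open>On the translates \<open>g W\<close> of a slice \<open>W\<close>, which are disjoint for distinct cosets \<open>g H\<close>,
  the \<open>H\<close>-equivariant map \<open>f\<close> extends to a \<open>G\<close>-equivariant one by \<open>g w \<mapsto> g f(w)\<close>.\<close>

lemma charts_of_subgroup_charts:
  assumes "has_equivariant_charts (G\<lparr>carrier := H\<rparr>) (subtopology T H) X \<phi>"
  shows "has_equivariant_charts G T X \<phi>"
  unfolding has_equivariant_charts_def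
proof
  fix x assume x: "x \<in> topspace X"
  then obtain P f where xP: "x \<in> P"
    and ch: "equivariant_chart (G\<lparr>carrier := H\<rparr>) (subtopology T H) X \<phi> P f"
    using assms by (auto simp: has_equivariant_charts_def)
  then have P: "openin X P" and Pinv: "\<And>h y. h \<in> H \<Longrightarrow> y \<in> P \<Longrightarrow> \<phi> h y \<in> P"
    and cf: "continuous_map (subtopology X P) T f" and fH: "f \<in> topspace (subtopology X P) \<rightarrow> H"
    and feq: "\<And>h y. h \<in> H \<Longrightarrow> y \<in> P \<Longrightarrow> f (\<phi> h y) = h \<otimes> f y"
    by (auto simp: equivariant_chart_def continuous_map_in_subtopology)
  obtain V where V: "openin X V" "x \<in> V"
    and sep: "\<And>g y. g \<in> carrier G \<Longrightarrow> y \<in> V \<Longrightarrow> \<phi> g y \<in> V \<Longrightarrow> g \<in> H"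
    using slice_neighbourhood[OF x] by metis
  define W where "W = V \<inter> P"
  have W: "openin X W" "x \<in> W"
    using P V xP by (auto simp: W_def)
  have WX: "\<And>y. y \<in> W \<Longrightarrow> y \<in> topspace X"
    using W openin_subset by blast
  have fG: "f y \<in> carrier G" if "y \<in> W" for y
    using that fH WX[OF that] H_carrier by (auto simp: W_def)
  \<comment> \<open>\<open>S g\<close> is the translate \<open>gW\<close>, written as a preimage so
    that its openness follows from continuity; \<open>f' g\<close> below is the extension rule on
    this translate.\<close>
  define S where "S g = {y \<in> topspace X. \<phi> (inv g) y \<in> W}" for g
  define Q where "Q = (\<Union>g\<in>carrier G. S g)"
  define f' where "f' g y = g \<otimes> f (\<phi> (inv g) y)" for g y
  have cact: "continuous_map X X (\<phi> g)" if "g \<in> carrier G" for g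
    using that by (intro continuous_map_act[of X "\<lambda>_. g", simplified]) (auto simp: topspace_group)
  have S: "openin X (S g)" if "g \<in> carrier G" for g
    unfolding S_def using that W by (intro openin_continuous_map_preimage[OF cact]) auto
  have Q: "openin X Q"
    unfolding Q_def using S by blast
  have SQ: "S g \<subseteq> Q" if "g \<in> carrier G" for g
    using that by (auto simp: Q_def)
  have QX: "Q \<subseteq> topspace X"
    using Q openin_subset by blast
  have cf': "continuous_map (subtopology (subtopology X Q) (S g)) T (f' g)" if g: "g \<in> carrier G" for g
  proof -
    have "continuous_map (subtopology X (S g)) (subtopology X P) (\<phi> (inv g))"
      using g by (auto simp: continuous_map_in_subtopology S_def W_def
          intro!: continuous_map_from_subtopology cact)
    from continuous_map_compose[OF this cf] show ?thesis
      unfolding f'_def subtopology_subtopology Int_absorb1[OF SQ[OF g]]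
      using g by (intro continuous_map_mult) (auto simp: comp_def topspace_group)
  qed
  \<comment> \<open>If \<open>y\<close> lies in both \<open>gW\<close> and \<open>g'W\<close>, then
    \<open>inv g' \<otimes> g\<close> moves a point of \<open>V\<close> into \<open>V\<close>, so it
    belongs to \<open>H\<close>, and \<open>H\<close>-equivariance of \<open>f\<close> makes the two
    values equal.\<close>
  have agree: "f' g y = f' g' y" if g: "g \<in> carrier G" "g' \<in> carrier G" and y: "y \<in> S g" "y \<in> S g'" for g g' y
  proof -
    have yX: "y \<in> topspace X"
      using y by (simp add: S_def)
    define w where "w = \<phi> (inv g) y"
    define k where "k = inv g' \<otimes> g"
    have w: "w \<in> W" and kG: "k \<in> carrier G"
      using y g by (auto simp: w_def S_def k_def)
    have w': "\<phi> (inv g') y = \<phi> k w"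
      using g yX by (simp add: w_def k_def act_mult)
    then have "k \<in> H"
      using sep[of k w] w y kG by (auto simp: S_def W_def)
    then have "f' g' y = g' \<otimes> (k \<otimes> f w)"
      using w by (simp add: f'_def w' feq W_def)
    also have "\<dots> = g \<otimes> f w"
      using g fG[OF w] by (simp add: k_def flip: m_assoc)
    finally show ?thesis
      by (simp add: f'_def w_def)
  qed
  have cover: "topspace (subtopology X Q) \<subseteq> (\<Union>g\<in>carrier G. S g)"
    by (auto simp: Q_def)
  have open_S: "openin (subtopology X Q) (S g)" if "g \<in> carrier G" for g
    using that S SQ by (simp add: openin_open_subtopology[OF Q])
  have agree': "f' g y = f' g' y"
    if "g \<in> carrier G" "g' \<in> carrier G" "y \<in> topspace (subtopology X Q) \<inter> S g \<inter> S g'" for g g' y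
    using that(3) by (intro agree[OF that(1,2)]) simp_all
  obtain F where cF: "continuous_map (subtopology X Q) T F"
    and F0: "\<And>y g. g \<in> carrier G \<Longrightarrow> y \<in> topspace (subtopology X Q) \<inter> S g \<Longrightarrow> F y = f' g y"
    using pasting_lemma_exists[OF cover open_S cf' agree'] by metis
  have F: "F y = f' g y" if "g \<in> carrier G" "y \<in> S g" for g y
    using that SQ[OF that(1)] QX by (intro F0) auto
  \<comment> \<open>Translation by \<open>k\<close> takes \<open>S g\<close> to
    \<open>S (k \<otimes> g)\<close>, and with these indices \<open>y\<close> and
    \<open>\<phi> k y\<close> come from the same point of \<open>W\<close>.\<close>
  have shift: "\<phi> k y \<in> S (k \<otimes> g) \<and> F (\<phi> k y) = k \<otimes> F y"
    if "k \<in> carrier G" "g \<in> carrier G" "y \<in> S g" for k g y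
  proof -
    have yX: "y \<in> topspace X" and w: "\<phi> (inv g) y \<in> W"
      using that by (auto simp: S_def)
    have eq: "\<phi> (inv (k \<otimes> g)) (\<phi> k y) = \<phi> (inv g) y"
      using that yX by (simp add: inv_mult_group act_mult)
    then have mem: "\<phi> k y \<in> S (k \<otimes> g)"
      using w that yX by (auto simp: S_def)
    then show ?thesis
      using F[OF _ mem] F[OF that(2,3)] that eq fG[OF w] by (simp add: f'_def m_assoc)
  qed
  have "equivariant_chart G T X \<phi> Q F"
    unfolding equivariant_chart_def
  proof (intro conjI ballI Q cF)
    fix k y assume k: "k \<in> carrier G" and "y \<in> Q"
    then obtain g where g: "g \<in> carrier G" "y \<in> S g"
      by (auto simp: Q_def)
    show "\<phi> k y \<in> Q" "F (\<phi> k y) = k \<otimes> F y"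
      using shift[OF k g] SQ[of "k \<otimes> g"] k g by auto
  qed
  moreover have "x \<in> Q"
    using x W by (auto simp: Q_def S_def intro!: bexI[of _ "\<one>"])
  ultimately show "\<exists>P f. x \<in> P \<and> equivariant_chart G T X \<phi> P f"
    by blast
qed

end

section \<open>Constructing free actions and transporting them to another space\<close>

text \<open>\<open>group_action\<close> asks for a homomorphism into the group of extensional
  bijections; the pointwise laws give one because \<open>\<phi> (inv g)\<close> inverts
  \<open>\<phi> g\<close>.\<close>

lemma (in top_group) free_continuous_actionI:
  assumes cont: "continuous_map (prod_topology T X) X (\<lambda>(g, x). \<phi> g x)"
    and ext: "\<And>g. g \<in> carrier G \<Longrightarrow> \<phi> g \<in> extensional (topspace X)"
    and one: "\<And>x. x \<in> topspace X \<Longrightarrow> \<phi> \<one> x = x"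
    and mult: "\<And>g h x. g \<in> carrier G \<Longrightarrow> h \<in> carrier G \<Longrightarrow> x \<in> topspace X \<Longrightarrow>
        \<phi> (g \<otimes> h) x = \<phi> g (\<phi> h x)"
    and free: "\<And>g x. g \<in> carrier G \<Longrightarrow> x \<in> topspace X \<Longrightarrow> \<phi> g x = x \<Longrightarrow> g = \<one>"
  shows "free_continuous_action G T X \<phi>"
proof -
  have closed: "\<phi> g x \<in> topspace X" if "g \<in> carrier G" "x \<in> topspace X" for g x
    using continuous_map_funspace[OF cont] that by (auto simp: topspace_group Pi_iff)
  have inverse: "\<phi> (inv g) (\<phi> g x) = x" "\<phi> g (\<phi> (inv g) x) = x"
    if "g \<in> carrier G" "x \<in> topspace X" for g x
    using that by (simp_all add: one flip: mult)
  have bij: "\<phi> g \<in> Bij (topspace X)" if "g \<in> carrier G" for g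
  proof -
    have "bij_betw (\<phi> g) (topspace X) (topspace X)"
      by (rule bij_betwI[of _ _ _ "\<phi> (inv g)"]) (use that inverse closed in auto)
    then show ?thesis
      using ext that by (simp add: Bij_def)
  qed
  have "\<phi> (g \<otimes> h) = compose (topspace X) (\<phi> g) (\<phi> h)" if "g \<in> carrier G" "h \<in> carrier G" for g h
    using that ext[of "g \<otimes> h"] by (intro extensionalityI[of _ "topspace X"]) (auto simp: compose_eq mult)
  then have "group_action G (topspace X) \<phi>"
    using bij by (simp add: group_action_def group_hom_def group_hom_axioms_def group_BijGroup
        is_group hom_def) (simp add: BijGroup_def)
  moreover have "stabilizer G \<phi> x = {\<one>}" if "x \<in> topspace X" for x
    using that free one by (auto simp: stabilizer_def)
  ultimately show ?thesis
    using cont by (simp add: free_continuous_action_def continuous_action_def)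
qed


text \<open>A nonzero cardinal factor of size at most \<open>|A|\<close> leaves an infinite
  \<open>|A|\<close> unchanged. This makes room for the induced space among the points of the
  original one.\<close>

lemma bij_finite_times_infinite:
  includes cardinal_syntax
  assumes "finite R" "R \<noteq> {}" "infinite A"
  shows "\<exists>b. bij_betw b (R \<times> A) A"
proof -
  have "|R| \<le>o |A|"
    using assms by (intro ordLess_imp_ordLeq finite_ordLess_infinite card_of_Well_order)
      (simp_all add: Field_card_of)
  then show ?thesis
    unfolding card_of_ordIso using card_of_Times_infinite[OF assms(3,2)] by simp
qed

text \<open>Transport of structure: the topology on \<open>S\<close> is pulled back along the
  inverse of \<open>e\<close>, which turns \<open>e\<close> into a homeomorphism.\<close>

lemma homeomorphic_copy:
  assumes e: "bij_betw e (topspace Z) S"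
  obtains Y e' where "homeomorphic_maps Z Y e e'" "topspace Y = S"
proof -
  define e' where "e' = inv_into (topspace Z) e"
  define Y where "Y = pullback_topology S e' Z"
  have e'e: "e' (e z) = z" if "z \<in> topspace Z" for z
    using e that by (simp add: e'_def bij_betw_inv_into_left)
  have ee': "e (e' y) = y" "e' y \<in> topspace Z" if "y \<in> S" for y
    using e that by (simp_all add: e'_def bij_betw_inv_into_right bij_betw_def inv_into_into)
  have S: "topspace Y = S"
    using ee' by (auto simp: Y_def topspace_pullback_topology)
  have "continuous_map Y Z e'"
    unfolding Y_def using continuous_map_pullback[OF continuous_map_id, of S e' Z] by simp
  moreover have "continuous_map Z Y e"
    unfolding Y_def
  proof (rule continuous_map_pullback')
    show "continuous_map Z Z (e' \<circ> e)"
      by (rule continuous_map_eq[OF continuous_map_id]) (simp add: e'e)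
    show "topspace Z \<subseteq> e -` S"
      using e by (auto simp: bij_betw_def)
  qed
  ultimately have "homeomorphic_maps Z Y e e'"
    by (simp add: homeomorphic_maps_def e'e ee' S)
  then show ?thesis
    using S that by blast
qed

text \<open>Conjugation by a homeomorphism preserves the action laws and freeness; the restriction
  to \<open>topspace Y\<close> makes the resulting maps extensional.\<close>

lemma (in top_group) free_continuous_action_transport:
  assumes h: "homeomorphic_maps Z Y e e'"
    and cont: "continuous_map (prod_topology T Z) Z (\<lambda>(g, z). \<Phi> g z)"
    and one: "\<And>z. z \<in> topspace Z \<Longrightarrow> \<Phi> \<one> z = z"
    and mult: "\<And>g k z. g \<in> carrier G \<Longrightarrow> k \<in> carrier G \<Longrightarrow> z \<in> topspace Z \<Longrightarrow>
        \<Phi> (g \<otimes> k) z = \<Phi> g (\<Phi> k z)"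
    and free: "\<And>g z. g \<in> carrier G \<Longrightarrow> z \<in> topspace Z \<Longrightarrow> \<Phi> g z = z \<Longrightarrow> g = \<one>"
  shows "free_continuous_action G T Y (\<lambda>g. \<lambda>y\<in>topspace Y. e (\<Phi> g (e' y)))"
proof -
  have ce: "continuous_map Z Y e" and ce': "continuous_map Y Z e'"
    and e'e: "\<And>z. z \<in> topspace Z \<Longrightarrow> e' (e z) = z" and ee': "\<And>y. y \<in> topspace Y \<Longrightarrow> e (e' y) = y"
    using h by (auto simp: homeomorphic_maps_def)
  have eY: "e z \<in> topspace Y" if "z \<in> topspace Z" for z
    using continuous_map_funspace[OF ce] that by auto
  have e'Z: "e' y \<in> topspace Z" if "y \<in> topspace Y" for y
    using continuous_map_funspace[OF ce'] that by auto
  have \<Phi>Z: "\<Phi> g z \<in> topspace Z" if "g \<in> carrier G" "z \<in> topspace Z" for g z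
    using continuous_map_funspace[OF cont] that by (auto simp: topspace_group Pi_iff)
  show ?thesis
  proof (rule free_continuous_actionI)
    have "continuous_map (prod_topology T Y) (prod_topology T Z) (\<lambda>p. (fst p, e' (snd p)))"
      using continuous_map_compose[OF continuous_map_snd ce']
      by (intro continuous_map_pairedI continuous_map_fst) (simp add: comp_def)
    then have "continuous_map (prod_topology T Y) Y (e \<circ> ((\<lambda>(g, z). \<Phi> g z) \<circ> (\<lambda>p. (fst p, e' (snd p)))))"
      by (intro continuous_map_compose[OF _ ce] continuous_map_compose[OF _ cont])
    then show "continuous_map (prod_topology T Y) Y (\<lambda>(g, y). (\<lambda>y\<in>topspace Y. e (\<Phi> g (e' y))) y)"
      by (rule continuous_map_eq) auto
    show "g = \<one>" if "g \<in> carrier G" "y \<in> topspace Y" "(\<lambda>y\<in>topspace Y. e (\<Phi> g (e' y))) y = y" for g y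
    proof -
      have "e (\<Phi> g (e' y)) = y"
        using that by simp
      then have "\<Phi> g (e' y) = e' y"
        using that e'e \<Phi>Z e'Z by metis
      then show ?thesis
        using free that e'Z by blast
    qed
  qed (use e'Z in \<open>simp_all add: one ee' mult \<Phi>Z eY e'e\<close>)
qed

section \<open>From the group to the subgroup: pulled back charts and the induced action\<close>

text \<open>The preimage under \<open>j\<close> of an invariant open set is open and
  \<open>H\<close>-invariant. On it, \<open>j\<close> followed by a chart for \<open>G\<close> and a
  continuous left \<open>H\<close>-equivariant map \<open>\<nu>\<close> from \<open>G\<close> to
  \<open>H\<close> is a chart for \<open>H\<close>.\<close>

lemma (in closed_finite_index) subgroup_charts_of_equivariant_map:
  assumes ca: "continuous_action (G\<lparr>carrier := H\<rparr>) (subtopology T H) X \<psi>"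
    and j: "continuous_map X Y j"
    and jeq: "\<And>h x. h \<in> H \<Longrightarrow> x \<in> topspace X \<Longrightarrow> j (\<psi> h x) = \<Phi> h (j x)"
    and charts: "has_equivariant_charts G T Y \<Phi>"
  shows "has_equivariant_charts (G\<lparr>carrier := H\<rparr>) (subtopology T H) X \<psi>"
  unfolding has_equivariant_charts_def
proof
  interpret sub: top_group_action "G\<lparr>carrier := H\<rparr>" "subtopology T H" X \<psi>
    by (intro top_group_action.intro top_group_subgroup top_group_action_axioms.intro ca)
  obtain \<rho> \<eta> where c\<eta>: "continuous_map T (subtopology T H) \<eta>"
    and \<eta>eq: "\<And>g h. g \<in> carrier G \<Longrightarrow> h \<in> H \<Longrightarrow> \<eta> (g \<otimes> h) = \<eta> g \<otimes> h"
    using coset_decomposition by metis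
  have \<eta>H: "\<eta> g \<in> H" if "g \<in> carrier G" for g
    using continuous_map_funspace[OF c\<eta>] that by (auto simp: topspace_group)
  \<comment> \<open>\<open>\<eta>\<close> commutes with right multiplication by \<open>H\<close>;
    conjugation with inversion turns this into compatibility with left multiplication.\<close>
  define \<nu> where "\<nu> g = inv (\<eta> (inv g))" for g
  have "continuous_map T T \<eta>"
    using c\<eta> by (simp add: continuous_map_in_subtopology)
  then have "continuous_map T T (\<lambda>g. \<eta> (inv g))"
    using continuous_map_compose[OF continuous_map_m_inv[of T "\<lambda>g. g"], of T \<eta>] by (simp add: comp_def)
  then have "continuous_map T T \<nu>"
    unfolding \<nu>_def by (rule continuous_map_m_inv)
  then have c\<nu>: "continuous_map T (subtopology T H) \<nu>"
    using subgroup.m_inv_closed[OF sub \<eta>H]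
    by (auto simp: continuous_map_in_subtopology topspace_group \<nu>_def)
  have \<nu>eq: "\<nu> (h \<otimes> g) = h \<otimes> \<nu> g" if "h \<in> H" "g \<in> carrier G" for h g
    using that \<eta>eq[of "inv g" "inv h"] \<eta>H[of "inv g"] H_carrier subgroup.m_inv_closed[OF sub]
    by (simp add: \<nu>_def inv_mult_group)
  fix x assume x: "x \<in> topspace X"
  then have "j x \<in> topspace Y"
    using continuous_map_funspace[OF j] by auto
  then obtain Q F where jQ: "j x \<in> Q" and "equivariant_chart G T Y \<Phi> Q F"
    using charts by (auto simp: has_equivariant_charts_def)
  then have Q: "openin Y Q" and Qinv: "\<And>k y. k \<in> carrier G \<Longrightarrow> y \<in> Q \<Longrightarrow> \<Phi> k y \<in> Q"
    and cF: "continuous_map (subtopology Y Q) T F"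
    and Feq: "\<And>k y. k \<in> carrier G \<Longrightarrow> y \<in> Q \<Longrightarrow> F (\<Phi> k y) = k \<otimes> F y"
    by (auto simp: equivariant_chart_def)
  have FG: "F y \<in> carrier G" if "y \<in> Q" for y
    using continuous_map_funspace[OF cF] that openin_subset[OF Q] by (auto simp: topspace_group)
  define P where "P = {x \<in> topspace X. j x \<in> Q}"
  have "continuous_map (subtopology X P) (subtopology Y Q) j"
    using j by (auto simp: continuous_map_in_subtopology P_def intro: continuous_map_from_subtopology)
  then have "continuous_map (subtopology X P) (subtopology T H) (\<nu> \<circ> (F \<circ> j))"
    by (intro continuous_map_compose[OF _ c\<nu>] continuous_map_compose[OF _ cF])
  moreover have "openin X P"
    unfolding P_def by (rule openin_continuous_map_preimage[OF j Q])
  ultimately have "equivariant_chart (G\<lparr>carrier := H\<rparr>) (subtopology T H) X \<psi> P (\<nu> \<circ> (F \<circ> j))"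
    using sub.act_closed Qinv
    by (simp add: equivariant_chart_def P_def jeq Feq FG \<nu>eq H_carrier)
  then show "\<exists>P f. x \<in> P \<and> equivariant_chart (G\<lparr>carrier := H\<rparr>) (subtopology T H) X \<psi> P f"
    using x jQ by (intro exI[of _ P] exI[of _ "\<nu> \<circ> (F \<circ> j)"]) (simp add: P_def)
qed

text \<open>A finite Hausdorff space is discrete, so each orbit is open, and by freeness sending
  \<open>g x\<close> to \<open>g\<close> is a well-defined chart on it. Finite spaces are treated
  directly because several copies of such a space need not fit into the type of its points.\<close>

lemma (in top_group) charts_of_finite_space:
  assumes fca: "free_continuous_action G T X \<phi>" and "finite (topspace X)" "Hausdorff_space X"
  shows "has_equivariant_charts G T X \<phi>"
  unfolding has_equivariant_charts_def
proof
  interpret top_group_action G T X \<phi>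
    using fca by unfold_locales (simp add: free_continuous_action_def)
  have X: "X = discrete_topology (topspace X)"
    using assms finite_topspace_imp_discrete_topology by metis
  fix x assume x: "x \<in> topspace X"
  have inj: "g = k" if "g \<in> carrier G" "k \<in> carrier G" "\<phi> g x = \<phi> k x" for g k
  proof -
    have "\<phi> (inv k \<otimes> g) x = x"
      using that x by (simp add: act_mult)
    then have "inv k \<otimes> g \<in> stabilizer G \<phi> x"
      using that by (simp add: stabilizer_def)
    then have "inv k \<otimes> g = \<one>"
      using fca x by (simp add: free_continuous_action_def)
    then show ?thesis
      using that by (metis inv_equality inv_closed inv_inv)
  qed
  define P where "P = (\<lambda>g. \<phi> g x) ` carrier G"
  define f where "f y = inv_into (carrier G) (\<lambda>g. \<phi> g x) y" for y
  have f: "f (\<phi> g x) = g" if "g \<in> carrier G" for g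
    unfolding f_def using that inj by (intro inv_into_f_f inj_onI) auto
  have PX: "P \<subseteq> topspace X"
    using x by (auto simp: P_def)
  have "openin X P"
    using PX by (subst X) simp
  moreover have "continuous_map (subtopology X P) T f"
    using f PX by (subst X) (auto simp: P_def topspace_group)
  moreover have "\<phi> k y \<in> P \<and> f (\<phi> k y) = k \<otimes> f y" if "k \<in> carrier G" "y \<in> P" for k y
  proof -
    obtain g where g: "g \<in> carrier G" "y = \<phi> g x"
      using \<open>y \<in> P\<close> by (auto simp: P_def)
    then have "\<phi> k y = \<phi> (k \<otimes> g) x"
      using that x by (simp add: act_mult)
    then show ?thesis
      using that g f[of "k \<otimes> g"] f[of g] by (auto simp: P_def)
  qed
  ultimately have "equivariant_chart G T X \<phi> P f"
    by (simp add: equivariant_chart_def)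
  moreover have "x \<in> P"
    using x by (auto simp: P_def intro!: image_eqI[of _ _ "\<one>"])
  ultimately show "\<exists>P f. x \<in> P \<and> equivariant_chart G T X \<phi> P f"
    by blast
qed

text \<open>The induced space \<open>G \<times>\<^sub>H X\<close> is modelled on \<open>R \<times> X\<close> with \<open>R\<close> a finite set of coset
  representatives: writing \<open>g r = r' h\<close> with \<open>r' \<in> R\<close> and \<open>h \<in> H\<close>, the action is
  \<open>g (r, x) = (r', h x)\<close>. For infinite \<open>X\<close> the set \<open>R \<times> X\<close> has the cardinality of \<open>X\<close>, so the
  induced space can be realized on the type of \<open>X\<close>.\<close>

lemma (in closed_finite_index) induced_action:
  fixes X :: "'x topology"
  assumes fca: "free_continuous_action (G\<lparr>carrier := H\<rparr>) (subtopology T H) X \<psi>"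
    and inf: "infinite (topspace X)"
  obtains R :: "'g set" and Y :: "'x topology" and \<Phi> j where "finite R"
    "prod_topology (discrete_topology R) X homeomorphic_space Y"
    "free_continuous_action G T Y \<Phi>" "continuous_map X Y j"
    "\<And>h x. h \<in> H \<Longrightarrow> x \<in> topspace X \<Longrightarrow> j (\<psi> h x) = \<Phi> h (j x)"
proof -
  have ca: "continuous_action (G\<lparr>carrier := H\<rparr>) (subtopology T H) X \<psi>"
    using fca by (simp add: free_continuous_action_def)
  interpret sub: top_group_action "G\<lparr>carrier := H\<rparr>" "subtopology T H" X \<psi>
    by (intro top_group_action.intro top_group_subgroup top_group_action_axioms.intro ca)
  note act = sub.act_closed[simplified] sub.act_one[simplified] sub.act_mult[simplified]
  obtain \<rho> \<eta> where c\<rho>: "continuous_map T (discrete_topology (\<rho> ` carrier G)) \<rho>"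
    and c\<eta>: "continuous_map T (subtopology T H) \<eta>"
    and fin: "finite (\<rho> ` carrier G)"
    and \<rho>G: "\<And>g. g \<in> carrier G \<Longrightarrow> \<rho> g \<in> carrier G"
    and dec: "\<And>g. g \<in> carrier G \<Longrightarrow> \<rho> g \<otimes> \<eta> g = g"
    and \<rho>eq: "\<And>g h. g \<in> carrier G \<Longrightarrow> h \<in> H \<Longrightarrow> \<rho> (g \<otimes> h) = \<rho> g"
    and \<eta>eq: "\<And>g h. g \<in> carrier G \<Longrightarrow> h \<in> H \<Longrightarrow> \<eta> (g \<otimes> h) = \<eta> g \<otimes> h"
    using coset_decomposition by metis
  have \<eta>H: "\<eta> g \<in> H" if "g \<in> carrier G" for g
    using continuous_map_funspace[OF c\<eta>] that by (auto simp: topspace_group)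
  define R where "R = \<rho> ` carrier G"
  define Z where "Z = prod_topology (discrete_topology R) X"
  define \<Psi> where "\<Psi> g z = (\<rho> (g \<otimes> fst z), \<psi> (\<eta> (g \<otimes> fst z)) (snd z))" for g and z :: "'g \<times> 'x"
  have RG: "r \<in> carrier G" if "r \<in> R" for r
    using that \<rho>G by (auto simp: R_def)
  have tZ: "topspace Z = R \<times> topspace X"
    by (simp add: Z_def)
  \<comment> \<open>The product \<open>k \<otimes> g\<close> differs from
    \<open>k \<otimes> \<rho> g\<close> by the right factor \<open>\<eta> g\<close> in
    \<open>H\<close>. The resulting cocycle identities give the composition law for
    \<open>\<Psi>\<close>.\<close>
  have key: "\<rho> (k \<otimes> \<rho> g) = \<rho> (k \<otimes> g)" "\<eta> (k \<otimes> \<rho> g) \<otimes> \<eta> g = \<eta> (k \<otimes> g)"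
    if "k \<in> carrier G" "g \<in> carrier G" for k g
  proof -
    have "k \<otimes> \<rho> g \<otimes> \<eta> g = k \<otimes> g"
      using that \<rho>G \<eta>H H_carrier dec by (simp add: m_assoc)
    then show "\<rho> (k \<otimes> \<rho> g) = \<rho> (k \<otimes> g)" "\<eta> (k \<otimes> \<rho> g) \<otimes> \<eta> g = \<eta> (k \<otimes> g)"
      using that \<rho>G \<eta>H \<rho>eq[of "k \<otimes> \<rho> g" "\<eta> g"] \<eta>eq[of "k \<otimes> \<rho> g" "\<eta> g"] by simp_all
  qed
  \<comment> \<open>Representatives represent themselves, so their factor in \<open>H\<close> is
    trivial; this gives the unit law.\<close>
  have R: "\<rho> r = r" "\<eta> r = \<one>" if r: "r \<in> R" for r
  proof -
    obtain g where g: "g \<in> carrier G" "r = \<rho> g"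
      using r by (auto simp: R_def)
    then show *: "\<rho> r = r"
      using key(1)[of \<one> g] \<rho>G by simp
    then show "\<eta> r = \<one>"
      using dec[of r] RG[OF r] \<eta>H[of r] H_carrier[of "\<eta> r"] by (simp add: r_cancel_one)
  qed
  have c\<Psi>: "continuous_map (prod_topology T Z) Z (\<lambda>(g, z). \<Psi> g z)"
  proof -
    let ?A = "prod_topology T Z"
    have cs: "continuous_map ?A Z snd"
      by (rule continuous_map_snd)
    have "continuous_map (discrete_topology R) T (\<lambda>r. r)"
      using RG by (auto simp: topspace_group)
    moreover have "continuous_map ?A (discrete_topology R) (fst \<circ> snd)"
      using cs unfolding Z_def by (rule continuous_map_fst_of)
    ultimately have "continuous_map ?A T ((\<lambda>r. r) \<circ> (fst \<circ> snd))"
      by (rule continuous_map_compose[rotated])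
    then have m: "continuous_map ?A T (\<lambda>p. fst p \<otimes> fst (snd p))"
      by (intro continuous_map_mult continuous_map_fst) (simp add: comp_def)
    have "continuous_map ?A X (snd \<circ> snd)"
      using cs unfolding Z_def by (rule continuous_map_snd_of)
    then have "continuous_map ?A X (\<lambda>p. \<psi> (\<eta> (fst p \<otimes> fst (snd p))) (snd (snd p)))"
      using continuous_map_compose[OF m c\<eta>] by (intro sub.continuous_map_act) (simp_all add: comp_def)
    moreover have "continuous_map ?A (discrete_topology R) (\<lambda>p. \<rho> (fst p \<otimes> fst (snd p)))"
      using continuous_map_compose[OF m c\<rho>] by (simp add: comp_def R_def)
    ultimately have "continuous_map ?A Z (\<lambda>p. \<Psi> (fst p) (snd p))"
      unfolding \<Psi>_def by (subst (2) Z_def) (intro continuous_map_pairedI)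
    then show ?thesis
      by (simp add: case_prod_beta')
  qed
  have one: "\<Psi> \<one> z = z" if "z \<in> topspace Z" for z
    using that R RG act by (auto simp: tZ \<Psi>_def)
  have mult: "\<Psi> (g \<otimes> k) z = \<Psi> g (\<Psi> k z)" if gk: "g \<in> carrier G" "k \<in> carrier G" and zZ: "z \<in> topspace Z" for g k z
  proof -
    obtain r x where z: "z = (r, x)" "r \<in> R" "x \<in> topspace X"
      using zZ tZ by auto
    then show ?thesis
      using gk RG[OF z(2)] key[of g "k \<otimes> r"] \<eta>H \<rho>G
      by (simp add: \<Psi>_def m_assoc flip: act(3))
  qed
  have free: "g = \<one>" if g: "g \<in> carrier G" and zZ: "z \<in> topspace Z" and fixed: "\<Psi> g z = z" for g z
  proof -
    obtain r x where z: "z = (r, x)" "r \<in> R" "x \<in> topspace X"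
      using zZ tZ by auto
    have r: "r \<in> carrier G" "g \<otimes> r \<in> carrier G"
      using RG z g by auto
    \<comment> \<open>A fixed point keeps the representative \<open>r\<close>, and freeness of
      \<open>\<psi>\<close> makes the factor in \<open>H\<close> trivial, so
      \<open>g \<otimes> r = r\<close>.\<close>
    have "\<rho> (g \<otimes> r) = r" "\<psi> (\<eta> (g \<otimes> r)) x = x"
      using fixed z by (auto simp: \<Psi>_def)
    moreover have "stabilizer (G\<lparr>carrier := H\<rparr>) \<psi> x = {\<one>}"
      using fca z by (simp add: free_continuous_action_def)
    ultimately have "\<eta> (g \<otimes> r) = \<one>"
      using \<eta>H[OF r(2)] by (auto simp: stabilizer_def)
    then have "g \<otimes> r = r"
      using dec[OF r(2)] \<open>\<rho> (g \<otimes> r) = r\<close> r by simp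
    then show ?thesis
      using g r by (simp add: l_cancel_one)
  qed
  have "R \<noteq> {}"
    by (auto simp: R_def)
  then obtain b where "bij_betw b (topspace Z) (topspace X)"
    using bij_finite_times_infinite[of R "topspace X"] fin inf tZ by (auto simp: R_def)
  then obtain Y e' where h: "homeomorphic_maps Z Y b e'"
    using homeomorphic_copy by metis
  define \<Phi> where "\<Phi> = (\<lambda>g. \<lambda>y\<in>topspace Y. b (\<Psi> g (e' y)))"
  have fY: "free_continuous_action G T Y \<Phi>"
    unfolding \<Phi>_def by (rule free_continuous_action_transport[OF h c\<Psi> one mult free])
  have cb: "continuous_map Z Y b" and e'b: "\<And>z. z \<in> topspace Z \<Longrightarrow> e' (b z) = z"
    using h by (auto simp: homeomorphic_maps_def)
  \<comment> \<open>This is the embedding sending \<open>x\<close> to the class of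
    \<open>(\<one>, x)\<close>. The representative of the coset \<open>H\<close> need not be
    \<open>\<one>\<close>, hence the correction by \<open>\<eta> \<one>\<close>.\<close>
  define i where "i x = (\<rho> \<one>, \<psi> (\<eta> \<one>) x)" for x
  have ci: "continuous_map X Z i"
    unfolding i_def Z_def using \<eta>H[of \<one>] H_carrier
    by (intro continuous_map_pairedI sub.continuous_map_act)
      (auto simp: R_def topspace_group)
  have iZ: "i x \<in> topspace Z" if "x \<in> topspace X" for x
    using continuous_map_funspace[OF ci] that by auto
  have ieq: "i (\<psi> h x) = \<Psi> h (i x)" if "h \<in> H" "x \<in> topspace X" for h x
  proof -
    \<comment> \<open>Both \<open>h\<close> and \<open>\<one>\<close> lie in the coset
      \<open>H\<close>, so only the second coordinate of \<open>i\<close> is affected by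
      \<open>h\<close>.\<close>
    have "\<rho> h = \<rho> \<one>" "\<eta> h = \<eta> \<one> \<otimes> h"
      using \<rho>eq[of \<one> h] \<eta>eq[of \<one> h] that H_carrier by auto
    then show ?thesis
      using that key[of h \<one>] \<eta>H \<rho>G H_carrier by (simp add: i_def \<Psi>_def flip: act(3))
  qed
  show ?thesis
  proof (rule that[of R Y \<Phi> "b \<circ> i"])
    show "continuous_map X Y (b \<circ> i)"
      using ci cb by (rule continuous_map_compose)
    show "prod_topology (discrete_topology R) X homeomorphic_space Y"
      using h by (auto simp: homeomorphic_space_def Z_def)
    show "(b \<circ> i) (\<psi> h x) = \<Phi> h ((b \<circ> i) x)" if "h \<in> H" "x \<in> topspace X" for h x
      using that iZ continuous_map_funspace[OF cb] by (auto simp: \<Phi>_def ieq e'b Pi_iff)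
  qed (use fin fY in \<open>simp_all add: R_def\<close>)
qed

section \<open>The equivalence for a class of spaces, and its two instances\<close>

text \<open>Both equivalences have the same proof: about the class \<open>Q\<close> it uses only
  that its members are Hausdorff and that finite disjoint unions of copies of a member, up to
  homeomorphism, stay in \<open>Q\<close>.\<close>

lemma (in closed_finite_index) all_principal_iff:
  fixes Q :: "'x topology \<Rightarrow> bool"
  assumes compT: "compact_space T"
    and haus: "\<And>X. Q X \<Longrightarrow> Hausdorff_space X"
    and Q: "\<And>X Y (R :: 'g set). Q X \<Longrightarrow> finite R \<Longrightarrow>
        prod_topology (discrete_topology R) X homeomorphic_space Y \<Longrightarrow> Q Y"
  shows "(\<forall>X \<phi>. Q X \<and> free_continuous_action (G\<lparr>carrier := H\<rparr>) (subtopology T H) X \<phi> \<longrightarrow>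
            principal_action (G\<lparr>carrier := H\<rparr>) (subtopology T H) X \<phi>) \<longleftrightarrow>
         (\<forall>X \<phi>. Q X \<and> free_continuous_action G T X \<phi> \<longrightarrow> principal_action G T X \<phi>)"
    (is "?L \<longleftrightarrow> ?R")
proof (intro iffI allI impI; elim conjE)
  fix X \<phi> assume L: ?L and X: "Q X" and fca: "free_continuous_action G T X \<phi>"
  interpret subgroup_of_action G T H X \<phi>
  proof
    show "continuous_action G T X \<phi>"
      using fca by (simp add: free_continuous_action_def)
    show "g = \<one>" if "x \<in> topspace X" "g \<in> carrier G" "\<phi> g x = x" for g x
    proof -
      have "g \<in> stabilizer G \<phi> x"
        using that by (simp add: stabilizer_def)
      then show ?thesis
        using fca that by (simp add: free_continuous_action_def)
    qed
  qed (fact compT haus[OF X])+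
  interpret sub: top_group_action "G\<lparr>carrier := H\<rparr>" "subtopology T H" X \<phi>
    using free_continuous_action_restrict[OF fca]
    by (intro top_group_action.intro top_group_subgroup top_group_action_axioms.intro)
      (simp add: free_continuous_action_def)
  have "principal_action (G\<lparr>carrier := H\<rparr>) (subtopology T H) X \<phi>"
    using L X free_continuous_action_restrict[OF fca] by blast
  then show "principal_action G T X \<phi>"
    by (intro charts_imp_principal charts_of_subgroup_charts sub.principal_imp_charts)
next
  fix X \<psi> assume R: ?R and X: "Q X"
    and fca: "free_continuous_action (G\<lparr>carrier := H\<rparr>) (subtopology T H) X \<psi>"
  then have ca: "continuous_action (G\<lparr>carrier := H\<rparr>) (subtopology T H) X \<psi>"
    by (simp add: free_continuous_action_def)
  interpret sub: top_group_action "G\<lparr>carrier := H\<rparr>" "subtopology T H" X \<psi>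
    by (intro top_group_action.intro top_group_subgroup top_group_action_axioms.intro ca)
  have "has_equivariant_charts (G\<lparr>carrier := H\<rparr>) (subtopology T H) X \<psi>"
  \<comment> \<open>The hypothesis on \<open>G\<close> concerns spaces with points of type
    \<open>'x\<close>, so the induced space must be realized on that type, which is done for
    infinite \<open>X\<close>.\<close>
  proof (cases "finite (topspace X)")
    case True
    then show ?thesis
      using sub.charts_of_finite_space fca haus X by blast
  next
    case False
    obtain R :: "'g set" and Y :: "'x topology" and \<Phi> j where ind: "finite R"
      "prod_topology (discrete_topology R) X homeomorphic_space Y"
      "free_continuous_action G T Y \<Phi>" "continuous_map X Y j"
      "\<And>h x. h \<in> H \<Longrightarrow> x \<in> topspace X \<Longrightarrow> j (\<psi> h x) = \<Phi> h (j x)"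
      using induced_action[OF fca False] by blast
    interpret Y: top_group_action G T Y \<Phi>
      using ind(3) by unfold_locales (simp add: free_continuous_action_def)
    have "principal_action G T Y \<Phi>"
      using R Q[OF X ind(1,2)] ind(3) by blast
    then show ?thesis
      by (intro subgroup_charts_of_equivariant_map[where \<Phi> = \<Phi>, OF ca ind(4) ind(5)] Y.principal_imp_charts)
  qed
  then show "principal_action (G\<lparr>carrier := H\<rparr>) (subtopology T H) X \<psi>"
    by (rule sub.charts_imp_principal)
qed

theorem lemma1p9:
  fixes G :: "('g, 'b) monoid_scheme" and T :: "'g topology" and H :: "'g set"
  assumes "compact_group G T"
    and "subgroup H G"
    and "closedin T H"
    and "finite (rcosets\<^bsub>G\<^esub> H)"
  shows
    "((\<forall>(X :: 'x topology) \<phi>.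
          Tychonoff_space X \<and>
          free_continuous_action (G\<lparr>carrier := H\<rparr>) (subtopology T H) X \<phi> \<longrightarrow>
          principal_action (G\<lparr>carrier := H\<rparr>) (subtopology T H) X \<phi>)
      \<longleftrightarrow>
      (\<forall>(X :: 'x topology) \<phi>.
          Tychonoff_space X \<and> free_continuous_action G T X \<phi> \<longrightarrow>
          principal_action G T X \<phi>))
     \<and>
     ((\<forall>(X :: 'x topology) \<phi>.
          compact_space X \<and> Hausdorff_space X \<and>
          free_continuous_action (G\<lparr>carrier := H\<rparr>) (subtopology T H) X \<phi> \<longrightarrow>
          principal_action (G\<lparr>carrier := H\<rparr>) (subtopology T H) X \<phi>)
      \<longleftrightarrow>
      (\<forall>(X :: 'x topology) \<phi>.
          compact_space X \<and> Hausdorff_space X \<and> free_continuous_action G T X \<phi> \<longrightarrow>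
          principal_action G T X \<phi>))"
proof -
  interpret closed_finite_index G T H
    using assms by (intro closed_finite_index.intro top_group.intro closed_finite_index_axioms.intro)
      (simp_all add: compact_group_def)
  have compT: "compact_space T"
    using assms(1) by (simp add: compact_group_def)
  have Tychonoff: "Tychonoff_space Y"
    if "Tychonoff_space X" "prod_topology (discrete_topology R) X homeomorphic_space Y"
    for X Y :: "'x topology" and R :: "'g set"
    using that homeomorphic_completely_regular_space[OF that(2)] homeomorphic_Hausdorff_space[OF that(2)]
    by (simp add: Tychonoff_space_def completely_regular_space_prod_topology
        completely_regular_space_discrete_topology Hausdorff_space_prod_topology)
  \<comment> \<open>Finiteness of \<open>R\<close> makes the discrete factor compact.\<close>
  have compact: "compact_space Y \<and> Hausdorff_space Y"
    if "compact_space X \<and> Hausdorff_space X" "finite R"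
      "prod_topology (discrete_topology R) X homeomorphic_space Y"
    for X Y :: "'x topology" and R :: "'g set"
    using that homeomorphic_compact_space[OF that(3)] homeomorphic_Hausdorff_space[OF that(3)]
    by (simp add: compact_space_prod_topology compact_space_discrete_topology
        Hausdorff_space_prod_topology)
  show ?thesis
    using all_principal_iff[of Tychonoff_space, OF compT _ Tychonoff]
      all_principal_iff[of "\<lambda>X. compact_space X \<and> Hausdorff_space X", OF compT _ compact]
    unfolding conj_assoc by (intro conjI) (simp_all only: Tychonoff_space_def)
qed

end
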